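(* The passports $[r;1^r]$, $[2^r,1;2^r,1]$, $[2^r;2^{r-1},1^2]$ have respective monodromy groups $\mathbb{Z}_r$, $D_{2(2r+1)}$, $D_{2(2r)}$.
   Context: Here $r$ is a positive integer. A dessin is a connected bicolored (black/white, every edge joining a black and a white vertex) graph equipped with a cyclic ordering (oriented counterclockwise) of the edges around each vertex; the dessins considered here are finite plane trees. The passport of a dessin is the pair of lists $[b_1,\dots,b_k;w_1,\dots,w_\ell]$, where $b_1,\dots,b_k$ are the degrees of the black vertices and $w_1,\dots,w_\ell$ are the degrees of the white vertices; within a list, $a^m$ denotes $m$ vertices of degree $a$. Label the edges of a dessin $1,\dots,n$, and let $\sigma_0\in S_n$ (resp. $\sigma_1\in S_n$) be the product of the cycles given by the counterclockwise cyclic orders of the edges around the black (resp. white) vertices. The monodromy group of the dessin is $\langle\sigma_0,\sigma_1,\sigma_\infty\rangle=\langle\sigma_0,\sigma_1\rangle$, where $\sigma_0\sigma_1\sigma_\infty=1$; it does not depend, up to isomorphism, on the labeling. Each of the three passports is realized by exactly one tree up to isomorphism (the star with $r$ edges, and the paths with $2r+1$ and $2r$ edges, respectively), and the monodromy group of the passport means the monodromy group of that tree, described up to isomorphism. $\mathbb{Z}_r$ is the cyclic group of order $r$, and $D_{2n}$ is the dihedral group of order $2n$.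
   Formalization: For the third passport the monodromy group is claimed only for r ≥ 2: when r = 1, the passport [2;1^2] is the path with two edges, whose monodromy group is Z_2 rather than D_4 of order 4, so the claim fails there. *)

theory Defs
  imports
    "Graph_Theory.Graph_Theory"
    "HOL-Algebra.Sym_Groups"
    "HOL-Algebra.Elementary_Groups"
    "HOL-Combinatorics.Orbits"
    "HOL-Library.Multiset"
begin

text \<open>
  A dessin is stored as a multigraph whose edges are arcs written from their black end (the tail)
  to their white end (the head). The direction only records the colours: walks, cycles and
  degrees below ignore it. \<open>rotation D v e\<close> is the edge following \<open>e\<close> counterclockwise around \<open>v\<close>.
\<close>

record ('v, 'e) dessin =
  graph :: "('v, 'e) pre_digraph"
  black :: "'v set"
  rotation :: "'v \<Rightarrow> 'e \<Rightarrow> 'e"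

definition white :: "('v, 'e) dessin \<Rightarrow> 'v set" where
  "white D = verts (graph D) - black D"

definition edges_at :: "('v, 'e) dessin \<Rightarrow> 'v \<Rightarrow> 'e set" where
  "edges_at D v = {e \<in> arcs (graph D). tail (graph D) e = v \<or> head (graph D) e = v}"

text \<open>
  \<^const>\<open>Digraph_Component.connected\<close> is connectedness of the underlying undirected graph.
  The premise on \<^const>\<open>edges_at\<close> is needed only for the one-vertex graph, because
  \<^const>\<open>cyclic_on\<close> is false on the empty set.
\<close>

definition is_dessin :: "('v, 'e) dessin \<Rightarrow> bool" where
  "is_dessin D \<longleftrightarrow>
     fin_digraph (graph D) \<and>
     Digraph_Component.connected (graph D) \<and>
     black D \<subseteq> verts (graph D) \<and>
     (\<forall>e \<in> arcs (graph D). tail (graph D) e \<in> black D \<and> head (graph D) e \<in> white D) \<and>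
     (\<forall>v \<in> verts (graph D). edges_at D v \<noteq> {} \<longrightarrow> cyclic_on (rotation D v) (edges_at D v))"

text \<open>
  Undirected cycles, with vertices \<open>vs\<close> and edges \<open>es\<close>. The predicate \<open>tree\<close> of the graph library is
  unsuitable: it excludes directed cycles only, and there are none when every arc goes from black
  to white.
\<close>

definition undirected_cycle :: "('v, 'e) pre_digraph \<Rightarrow> 'v list \<Rightarrow> 'e list \<Rightarrow> bool" where
  "undirected_cycle G vs es \<longleftrightarrow>
     es \<noteq> [] \<and> length vs = length es \<and> distinct vs \<and> distinct es \<and> set es \<subseteq> arcs G \<and>
     (\<forall>i < length es. {tail G (es ! i), head G (es ! i)} = {vs ! i, vs ! (Suc i mod length es)})"

text \<open>
  No planarity condition is needed: a tree with any choice of rotations has a single face, so it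
  always has genus 0.
\<close>

definition plane_tree :: "('v, 'e) dessin \<Rightarrow> bool" where
  "plane_tree D \<longleftrightarrow> is_dessin D \<and> (\<nexists>vs es. undirected_cycle (graph D) vs es)"

definition degree_at :: "('v, 'e) dessin \<Rightarrow> 'v \<Rightarrow> nat" where
  "degree_at D v = card (edges_at D v)"

definition passport :: "('v, 'e) dessin \<Rightarrow> nat multiset \<times> nat multiset" where
  "passport D = (image_mset (degree_at D) (mset_set (black D)),
                 image_mset (degree_at D) (mset_set (white D)))"

definition labelling :: "('v, 'e) dessin \<Rightarrow> ('e \<Rightarrow> nat) \<Rightarrow> bool" where
  "labelling D l \<longleftrightarrow> bij_betw l (arcs (graph D)) {1..card (arcs (graph D))}"

text \<open>
  The cycles of a product of disjoint cycles act separately, so the product of the cyclic orders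
  around the black vertices sends an edge to its successor around its own black end.
\<close>

definition relabel :: "('v, 'e) dessin \<Rightarrow> ('e \<Rightarrow> nat) \<Rightarrow> ('e \<Rightarrow> 'e) \<Rightarrow> nat \<Rightarrow> nat" where
  "relabel D l f = (\<lambda>i. if i \<in> {1..card (arcs (graph D))}
                        then l (f (inv_into (arcs (graph D)) l i)) else i)"

definition sigma0 :: "('v, 'e) dessin \<Rightarrow> ('e \<Rightarrow> nat) \<Rightarrow> nat \<Rightarrow> nat" where
  "sigma0 D l = relabel D l (\<lambda>e. rotation D (tail (graph D) e) e)"

definition sigma1 :: "('v, 'e) dessin \<Rightarrow> ('e \<Rightarrow> nat) \<Rightarrow> nat \<Rightarrow> nat" where
  "sigma1 D l = relabel D l (\<lambda>e. rotation D (head (graph D) e) e)"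

definition sigma_inf :: "('v, 'e) dessin \<Rightarrow> ('e \<Rightarrow> nat) \<Rightarrow> nat \<Rightarrow> nat" where
  "sigma_inf D l = (let S = sym_group (card (arcs (graph D)))
                    in inv\<^bsub>S\<^esub> (sigma0 D l \<otimes>\<^bsub>S\<^esub> sigma1 D l))"

definition monodromy_group :: "('v, 'e) dessin \<Rightarrow> ('e \<Rightarrow> nat) \<Rightarrow> (nat \<Rightarrow> nat) monoid" where
  "monodromy_group D l =
     subgroup_generated (sym_group (card (arcs (graph D)))) {sigma0 D l, sigma1 D l, sigma_inf D l}"

text \<open>
  The dihedral group of order \<open>2 * n\<close>, for \<open>n > 0\<close>: with a rotation \<open>\<rho>\<close> of order \<open>n\<close> and a
  reflection \<open>\<tau>\<close>, the pair \<open>(a, False)\<close> stands for \<open>\<rho>\<^sup>a\<close> and \<open>(a, True)\<close> for \<open>\<rho>\<^sup>a \<tau>\<close>. This is the semidirect product of the integers modulo \<open>n\<close> with a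
  group of order 2 acting by inversion. For \<open>n = 2\<close> it is the Klein four-group, which has no
  faithful action on 2 points.
\<close>

definition dihedral_group :: "nat \<Rightarrow> (int \<times> bool) monoid" where
  "dihedral_group n =
     \<lparr> carrier = {0..<int n} \<times> UNIV,
       mult = (\<lambda>(a, s) (b, t). ((a + (if s then - b else b)) mod int n, s \<noteq> t)),
       one = (0, False) \<rparr>"

lemma group_dihedral_group:
  assumes "n > 0"
  shows "group (dihedral_group n)"
proof (rule groupI)
  fix x y z
  show "x \<otimes>\<^bsub>dihedral_group n\<^esub> y \<otimes>\<^bsub>dihedral_group n\<^esub> z =
        x \<otimes>\<^bsub>dihedral_group n\<^esub> (y \<otimes>\<^bsub>dihedral_group n\<^esub> z)"
    by (cases x; cases y; cases z) (auto simp: dihedral_group_def mod_simps algebra_simps)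
next
  fix x assume "x \<in> carrier (dihedral_group n)"
  then obtain a s where x: "x = (a, s)" "0 \<le> a" "a < int n"
    by (auto simp: dihedral_group_def)
  show "\<exists>y\<in>carrier (dihedral_group n). y \<otimes>\<^bsub>dihedral_group n\<^esub> x = \<one>\<^bsub>dihedral_group n\<^esub>"
    by (rule bexI[of _ "(if s then a else (- a) mod int n, s)"])
       (use x assms in \<open>auto simp: dihedral_group_def mod_simps\<close>)
qed (use assms in \<open>auto simp: dihedral_group_def\<close>)

lemma order_dihedral_group: "order (dihedral_group n) = 2 * n"
  by (simp add: order_def dihedral_group_def card_cartesian_product)

end

theory Submission
  imports Defs "HOL-Algebra.Multiplicative_Group"
begin

text \<open>
  Let \<open>n\<close> be the number of edges, which is the sum of the black degrees. Connectedness of the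
  dessin says that no proper nonempty set of edges is closed under both \<open>\<sigma>\<^sub>0\<close> and \<open>\<sigma>\<^sub>1\<close>
  (\<open>turn_closed_imp_all\<close>), so the monodromy group, which these two permutations generate, acts
  transitively on the edges.

  If there is one black vertex and all white vertices are leaves, then \<open>\<sigma>\<^sub>1\<close> is trivial and \<open>\<sigma>\<^sub>0\<close> is an
  \<open>n\<close>-cycle, so the group is cyclic of order \<open>n\<close>.

  For the other two passports all degrees are 1 or 2, so \<open>\<sigma>\<^sub>0\<close> and \<open>\<sigma>\<^sub>1\<close> square to the identity. One
  of them, \<open>a\<close>, belongs to a colour with a leaf, hence fixes an edge \<open>x\<close>, and with a vertex of
  degree 2 (in the last passport because \<open>r \<ge> 2\<close>), hence is not the identity. Call the other one \<open>b\<close> and put \<open>c = a b\<close>. Every element of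
  the group is a power of \<open>c\<close>, possibly times \<open>a\<close>, and \<open>a x = x\<close>; by transitivity the powers of \<open>c\<close>
  alone move \<open>x\<close> to every edge, so \<open>c\<close> is an \<open>n\<close>-cycle. A power of an \<open>n\<close>-cycle that fixes \<open>x\<close> is
  the identity, so \<open>a\<close> is not a power of \<open>c\<close>. As \<open>a c a = c\<^sup>-\<^sup>1\<close>, the group is dihedral of order \<open>2 n\<close>
  (\<open>transitive_involutions_iso_dihedral_group\<close>). This argument needs neither the shape of the tree
  nor the absence of cycles.

  Trees with the three passports are obtained by attaching the vertices \<open>1, \<dots>, n\<close> one after another
  to smaller ones (\<open>ex_attachment_tree\<close>): all to 0 for the star, each to its predecessor for
  the paths.
\<close>

section \<open>Groups generated by one element or by two involutions\<close>

lemma (in group) subgroup_generated_iso_imageI: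
  assumes "group H" "h \<in> hom H G" "inj_on h (carrier H)"
    and "X \<subseteq> h ` carrier H" "h ` carrier H \<subseteq> carrier (subgroup_generated G X)"
  shows "subgroup_generated G X \<cong> H"
proof -
  interpret hom: group_hom H G h
    using assms(1,2) by (simp add: group_hom_def group_hom_axioms_def is_group)
  have "carrier (subgroup_generated G X) \<subseteq> h ` carrier H"
    using assms(4) by (intro subgroup_generated_minimal hom.img_is_subgroup)
  then have image: "h ` carrier H = carrier (subgroup_generated G X)"
    using assms(5) by blast
  have "h \<in> iso H (subgroup_generated G X)"
    using assms(2,3) image by (auto simp: iso_def bij_betw_def hom_def)
  then show ?thesis
    by (meson assms(1) group.iso_sym is_isoI)
qed

lemma (in group) int_pow_mod_ord:
  assumes "x \<in> carrier G"
  shows "x [^] (k mod int (ord x)) = x [^] (k::int)"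
  using assms by (simp add: int_pow_eq mod_eq_dvd_iff[symmetric] minus_mod_eq_mult_div)

lemma (in group) int_pow_inj_on_ord:
  assumes "x \<in> carrier G"
  shows "inj_on (\<lambda>k::int. x [^] k) {0..<int (ord x)}"
proof (rule inj_onI)
  fix i j :: int
  assume ij: "i \<in> {0..<int (ord x)}" "j \<in> {0..<int (ord x)}" and "x [^] i = x [^] j"
  then have "i mod int (ord x) = j mod int (ord x)"
    using assms by (metis int_pow_eq mod_eq_dvd_iff)
  then show "i = j"
    using ij by simp
qed

lemma (in group) int_pow_in_subgroup_generated:
  assumes "x \<in> carrier (subgroup_generated G X)"
  shows "x [^] (k::int) \<in> carrier (subgroup_generated G X)"
  using assms by (simp add: subgroup_int_pow_closed subgroup_subgroup_generated)

lemma (in group) cyclic_iso_integer_mod_group: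
  assumes c: "c \<in> carrier G" and "ord c > 0"
  shows "subgroup_generated G {c, \<one>} \<cong> integer_mod_group (ord c)"
proof (rule subgroup_generated_iso_imageI)
  let ?h = "\<lambda>k::int. c [^] k"
  show "?h \<in> hom (integer_mod_group (ord c)) G"
    using c by (auto simp: hom_def int_pow_mod_ord int_pow_mult)
  show "inj_on ?h (carrier (integer_mod_group (ord c)))"
    using assms by (simp add: carrier_integer_mod_group int_pow_inj_on_ord)
  have "?h (1 mod int (ord c)) = c" "?h 0 = \<one>"
    using c by (simp_all add: int_pow_mod_ord)
  moreover have "1 mod int (ord c) \<in> carrier (integer_mod_group (ord c))"
    "0 \<in> carrier (integer_mod_group (ord c))"
    using assms by (simp_all add: carrier_integer_mod_group)
  ultimately show "{c, \<one>} \<subseteq> ?h ` carrier (integer_mod_group (ord c))"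
    by (metis (no_types, lifting) empty_subsetI image_eqI insert_subset)
  have "c \<in> carrier (subgroup_generated G {c, \<one>})"
    using c subgroup_generated_subset_carrier_subset[of "{c, \<one>}"] by simp
  then show "?h ` carrier (integer_mod_group (ord c)) \<subseteq> carrier (subgroup_generated G {c, \<one>})"
    by (auto intro: int_pow_in_subgroup_generated)
qed simp

text \<open>
  The hypothesis that \<open>a\<close> is not a power of \<open>a b\<close> excludes exactly the cases \<open>a = \<one>\<close> and \<open>b = \<one>\<close>,
  in which \<open>a b\<close> alone generates the group. The case \<open>a = b \<noteq> \<one>\<close> is included: the
  dihedral group then has order 2.
\<close>

lemma (in group) involutions_iso_dihedral_group:
  assumes a: "a \<in> carrier G" "a \<otimes> a = \<one>" and b: "b \<in> carrier G" "b \<otimes> b = \<one>"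
    and pos: "ord (a \<otimes> b) > 0" and notin: "a \<notin> range (\<lambda>k::int. (a \<otimes> b) [^] k)"
  shows "subgroup_generated G {a, b} \<cong> dihedral_group (ord (a \<otimes> b))"
proof -
  define c where "c = a \<otimes> b"
  define n where "n = ord c"
  \<comment> \<open>the pair \<open>(k, s)\<close> encodes a rotation \<open>c\<^sup>k\<close> or a reflection \<open>c\<^sup>k a\<close>\<close>
  define h where "h = (\<lambda>(k::int, s). c [^] k \<otimes> (if s then a else \<one>))"
  have c: "c \<in> carrier G" and n: "n > 0"
    using a b pos by (simp_all add: c_def n_def)
  have invs: "inv a = a" "inv b = b"
    using a b by (simp_all add: inv_equality)
  have ac: "a \<otimes> c = b"
    using a b by (metis c_def l_one m_assoc)
  have aca: "a \<otimes> c \<otimes> a = inv c"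
    using a b by (simp only: ac) (simp add: c_def inv_mult_group invs)
  have "(\<lambda>x. a \<otimes> x \<otimes> a) \<in> hom G G"
  proof (rule homI)
    fix x y assume xy: "x \<in> carrier G" "y \<in> carrier G"
    have "a \<otimes> x \<otimes> a \<otimes> (a \<otimes> y \<otimes> a) = a \<otimes> x \<otimes> (a \<otimes> a) \<otimes> y \<otimes> a"
      using a(1) xy by (simp add: m_assoc)
    then show "a \<otimes> (x \<otimes> y) \<otimes> a = a \<otimes> x \<otimes> a \<otimes> (a \<otimes> y \<otimes> a)"
      using a xy by (simp add: m_assoc)
  qed (use a in auto)
  then interpret conj: group_hom G G "\<lambda>x. a \<otimes> x \<otimes> a"
    by (simp add: group_hom_def group_hom_axioms_def is_group)
  have conj_pow: "a \<otimes> c [^] k \<otimes> a = c [^] (- k)" for k :: int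
    using conj.hom_int_pow[of c k] c by (simp add: aca int_pow_inv int_pow_neg)
  \<comment> \<open>a reflection moves to the right past a rotation, inverting it\<close>
  have swap: "a \<otimes> c [^] k = c [^] (- k) \<otimes> a" for k :: int
  proof -
    have "a \<otimes> c [^] k = a \<otimes> c [^] k \<otimes> (a \<otimes> a)"
      using a c by simp
    also have "\<dots> = a \<otimes> c [^] k \<otimes> a \<otimes> a"
      using a(1) c by (simp add: m_assoc)
    finally show ?thesis
      by (simp only: conj_pow)
  qed
  have pow_mod: "c [^] (k mod int n) = c [^] k" for k :: int
    using c by (simp add: n_def int_pow_mod_ord)
  have reflect: "a \<otimes> (c [^] k \<otimes> y) = c [^] (- k) \<otimes> (a \<otimes> y)" if "y \<in> carrier G" for k :: int and y
    using a(1) c that swap[of k] by (metis int_pow_closed m_assoc)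
  have absorb: "c [^] i \<otimes> (c [^] j \<otimes> y) = c [^] (i + j) \<otimes> y" if "y \<in> carrier G" for i j :: int and y
    using c that by (simp add: m_assoc int_pow_mult)
  have "subgroup_generated G {a, b} \<cong> dihedral_group n"
  proof (rule subgroup_generated_iso_imageI)
    show "group (dihedral_group n)"
      using n by (rule group_dihedral_group)
    show "h \<in> hom (dihedral_group n) G"
    proof (rule homI)
      fix x y assume "x \<in> carrier (dihedral_group n)" "y \<in> carrier (dihedral_group n)"
      obtain i s j t where [simp]: "x = (i, s)" "y = (j, t)"
        by (cases x; cases y)
      show "h (x \<otimes>\<^bsub>dihedral_group n\<^esub> y) = h x \<otimes> h y"
        using a c
        by (simp add: h_def dihedral_group_def pow_mod m_assoc reflect swap absorb
            flip: int_pow_mult)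
    qed (use a c in \<open>auto simp: h_def\<close>)
    show "inj_on h (carrier (dihedral_group n))"
    proof (rule inj_onI)
      fix x y assume xy: "x \<in> carrier (dihedral_group n)" "y \<in> carrier (dihedral_group n)" "h x = h y"
      obtain i s j t where [simp]: "x = (i, s)" "y = (j, t)"
        by (cases x; cases y)
      have not_power: "c [^] p \<otimes> a \<noteq> c [^] q" for p q :: int
      proof
        assume "c [^] p \<otimes> a = c [^] q"
        then have "c [^] (- p) \<otimes> c [^] q = a"
          using absorb[of a "- p" p] a(1) by simp
        then have "a = c [^] (- p + q)"
          using c int_pow_mult[of c "- p" q] by (simp only:)
        then show False
          using notin by (auto simp only: c_def)
      qed
      have "s = t"
        using xy(3) not_power[of i j] not_power[of j i] c
        by (cases s; cases t) (auto simp: h_def)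
      then have "c [^] i = c [^] j"
        using xy(3) a c by (auto simp: h_def split: if_splits)
      then have "i = j"
        using xy(1,2) int_pow_inj_on_ord[OF c]
        by (auto simp: dihedral_group_def n_def inj_on_def)
      with \<open>s = t\<close> show "x = y"
        by simp
    qed
    have "h (0, True) = a"
      using a by (simp add: h_def)
    moreover have "h ((- 1) mod int n, True) = b"
      using a b c swap[of 1] ac by (simp add: h_def pow_mod)
    ultimately show "{a, b} \<subseteq> h ` carrier (dihedral_group n)"
      using n by (auto simp: dihedral_group_def intro: rev_image_eqI)
    let ?K = "subgroup_generated G {a, b}"
    have K: "subgroup (carrier ?K) G" "a \<in> carrier ?K" "b \<in> carrier ?K"
      using a b subgroup_generated_subset_carrier_subset[of "{a, b}"]
      by (simp_all add: subgroup_subgroup_generated)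
    then have "c \<in> carrier ?K"
      by (simp add: c_def subgroup.m_closed)
    then show "h ` carrier (dihedral_group n) \<subseteq> carrier ?K"
      using K by (auto simp: h_def subgroup.m_closed subgroup.one_closed
          int_pow_in_subgroup_generated)
  qed
  then show ?thesis
    by (simp add: n_def c_def)
qed

section \<open>Permutations acting transitively\<close>

lemma sym_group_nat_pow: "p [^]\<^bsub>sym_group n\<^esub> (k::nat) = p ^^ k"
  by (induction k) (simp_all add: sym_group_def nat_pow_def funpow_Suc_right del: funpow.simps(2))

text \<open>A power of a cycle commutes with it, so on the cycle it fixes all points or none.\<close>

lemma cyclic_on_funpow_fixes:
  assumes cyc: "cyclic_on c S" and x: "x \<in> S" "(c ^^ m) x = x" and "y \<in> S"
  shows "(c ^^ m) y = y"
proof -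
  have "y \<in> orbit c x"
    using assms by (simp add: orbit_cyclic_eq3)
  then show ?thesis
    by induction (metis x(2) funpow_swap1)+
qed

lemma ord_cyclic_on:
  assumes c: "c permutes {1..n}" and cyc: "cyclic_on c {1..n}"
  shows "group.ord (sym_group n) c = n"
proof -
  interpret S: group "sym_group n"
    by (rule sym_group_is_group)
  define N where "N = S.ord c"
  have carr: "c \<in> carrier (sym_group n)"
    using c by (simp add: sym_group_carrier)
  have pow_id: "c ^^ m = id \<longleftrightarrow> N dvd m" for m
    using S.pow_eq_id[OF carr, of m] by (simp add: sym_group_nat_pow N_def sym_group_one)
  have fixed: "c ^^ m = id" if "(c ^^ m) x = x" "x \<in> {1..n}" for m x
  proof
    fix y
    show "(c ^^ m) y = id y"
    proof (cases "y \<in> {1..n}")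
      case True
      with cyclic_on_funpow_fixes[OF cyc that(2,1)] show ?thesis by simp
    next
      case False
      then show ?thesis
        using permutes_not_in[OF permutes_funpow[OF c], of y m] by simp
    qed
  qed
  obtain x where x: "x \<in> {1..n}" "{1..n} = orbit c x"
    using cyc unfolding cyclic_on_def by blast
  have "x \<in> orbit c x"
    using x(1) unfolding x(2) .
  then obtain m where "m > 0" "(c ^^ m) x = x"
    by (auto simp: orbit_altdef)
  then have "N > 0"
    using fixed[OF _ x(1), of m] pow_id[of m] by (auto intro: Nat.gr0I)
  have "(c ^^ N) x = x"
    using pow_id[of N] by simp
  then have "{1..n} = (\<lambda>m. (c ^^ m) x) ` {..<N}"
    using x(2) orbit_altdef_bounded[of N c x] \<open>N > 0\<close> by auto
  moreover have "inj_on (\<lambda>m. (c ^^ m) x) {..<N}"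
  proof (rule linorder_inj_onI)
    fix i j assume ij: "i < j" "i \<in> {..<N}" "j \<in> {..<N}"
    show "(c ^^ i) x \<noteq> (c ^^ j) x"
    proof
      assume "(c ^^ i) x = (c ^^ j) x"
      also have "(c ^^ j) x = (c ^^ (j - i)) ((c ^^ i) x)"
        using ij by (simp flip: funpow_add comp_apply[of "c ^^ (j - i)"])
      finally have "c ^^ (j - i) = id"
        using cyclic_on_funpow_in[OF cyc x(1)] by (metis fixed)
      then show False
        using ij pow_id[of "j - i"] by (auto dest: dvd_imp_le)
    qed
  qed auto
  ultimately have "n = N"
    by (metis card_atLeastAtMost card_image card_lessThan diff_Suc_1)
  then show ?thesis
    by (simp add: N_def)
qed

text \<open>
  Since \<open>a\<close> fixes \<open>x\<close> and inverts \<open>c = a \<circ> b\<close>, the cyclic group generated by \<open>c\<close> has the same orbit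
  of \<open>x\<close> as the whole group.
\<close>

lemma product_of_involutions_cyclic_on:
  assumes ab: "a permutes S" "b permutes S" "finite S" "a \<circ> a = id" "b \<circ> b = id"
    and x: "x \<in> S" "a x = x"
    and trans: "\<And>T. \<lbrakk>T \<subseteq> S; T \<noteq> {}; a ` T \<subseteq> T; b ` T \<subseteq> T\<rbrakk> \<Longrightarrow> T = S"
  shows "cyclic_on (a \<circ> b) S"
proof -
  define c where "c = a \<circ> b"
  define d where "d = b \<circ> a"
  have aa: "a (a y) = y" and bb: "b (b y) = y" for y
    using ab(4,5) by (metis comp_apply id_apply)+
  have c: "c permutes S" "permutation c"
    using ab by (auto simp: c_def permutes_compose permutation_permutes)
  have "inv' c = d"
    using aa bb by (intro inv_unique_comp) (auto simp: c_def d_def)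
  then have orbit_d: "orbit d x = orbit c x"
    using orbit_inv_eq[OF c(2)] by metis
  have "a (c y) = d (a y)" for y
    by (simp add: c_def d_def aa)
  then have a_c: "a ((c ^^ k) x) = (d ^^ k) x" for k
    by (induction k) (simp_all add: x)
  have d: "permutation d"
    using ab by (auto simp: d_def intro!: permutes_compose simp: permutation_permutes)
  have a_closed: "a y \<in> orbit c x" if "y \<in> orbit c x" for y
  proof -
    from that obtain k where "y = (c ^^ k) x"
      by (auto simp: orbit_altdef_permutation[OF c(2)])
    then have "a y \<in> orbit d x"
      using a_c by (auto simp: orbit_altdef_permutation[OF d])
    then show ?thesis
      by (simp add: orbit_d)
  qed
  have "b y = a (c y)" for y
    by (simp add: c_def aa)
  then have b_closed: "b y \<in> orbit c x" if "y \<in> orbit c x" for y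
    using that a_closed by (simp add: orbit.step)
  have "orbit c x = S"
    using a_closed b_closed permutes_orbit_subset[OF c(1) x(1)] orbit_nonempty[of c x]
    by (intro trans) auto
  then show ?thesis
    using x(1) by (auto simp: cyclic_on_def c_def)
qed

lemma transitive_involutions_iso_dihedral_group:
  assumes a: "a permutes {1..n}" "a \<circ> a = id" and b: "b permutes {1..n}" "b \<circ> b = id"
    and x: "x \<in> {1..n}" "a x = x" and "a \<noteq> id"
    and trans: "\<And>T. \<lbrakk>T \<subseteq> {1..n}; T \<noteq> {}; a ` T \<subseteq> T; b ` T \<subseteq> T\<rbrakk> \<Longrightarrow> T = {1..n}"
  shows "subgroup_generated (sym_group n) {a, b} \<cong> dihedral_group n"
proof -
  interpret S: group "sym_group n"
    by (rule sym_group_is_group)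
  let ?c = "a \<otimes>\<^bsub>sym_group n\<^esub> b"
  have c_eq: "?c = a \<circ> b"
    by (simp add: sym_group_mult)
  have c: "?c permutes {1..n}" and carr: "?c \<in> carrier (sym_group n)"
    using a b by (auto simp: c_eq permutes_compose sym_group_carrier)
  have cyc: "cyclic_on ?c {1..n}"
    unfolding c_eq using a b x trans by (intro product_of_involutions_cyclic_on) auto
  have ord: "S.ord ?c = n"
    using c cyc by (rule ord_cyclic_on)
  have n: "n > 0"
    using x by auto
  have "a \<notin> range (\<lambda>k::int. ?c [^]\<^bsub>sym_group n\<^esub> k)"
  proof
    assume "a \<in> range (\<lambda>k::int. ?c [^]\<^bsub>sym_group n\<^esub> k)"
    then obtain k :: int where "a = ?c [^]\<^bsub>sym_group n\<^esub> (k mod int n)"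
      using S.int_pow_mod_ord[OF carr] ord by auto
    also have "k mod int n = int (nat (k mod int n))"
      using n by simp
    finally have pow: "a = ?c ^^ nat (k mod int n)"
      by (metis int_pow_int sym_group_nat_pow)
    have "a y = y" for y
    proof (cases "y \<in> {1..n}")
      case True
      then show ?thesis
        using cyclic_on_funpow_fixes[OF cyc x(1)] x(2) pow by metis
    next
      case False
      then show ?thesis
        using a(1) by (simp add: permutes_not_in)
    qed
    with \<open>a \<noteq> id\<close> show False
      by auto
  qed
  then show ?thesis
    using S.involutions_iso_dihedral_group[of a b] a b ord n
    by (simp add: sym_group_carrier sym_group_mult sym_group_one)
qed

section \<open>Rotations of a dessin\<close>

lemma cyclic_on_card_le_2:
  assumes "cyclic_on f A" "card A \<le> 2" "x \<in> A"
  shows "f (f x) = x"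
proof (rule ccontr)
  assume neq: "f (f x) \<noteq> x"
  have fin: "finite A" and fx: "f x \<in> A" "f (f x) \<in> A"
    using assms by (auto intro: finite_cyclic_on cyclic_on_inI)
  have "f x \<noteq> x"
    using neq by auto
  then have "f (f x) \<noteq> f x"
    using orbit_cyclic_eq3[OF assms(1) fx(1)] orbit_eq_singleton_iff[of f "f x"] assms(3) by auto
  then have "card {x, f x, f (f x)} = 3"
    using neq \<open>f x \<noteq> x\<close> by auto
  moreover have "card {x, f x, f (f x)} \<le> card A"
    using fin fx assms(3) by (intro card_mono) auto
  ultimately show False
    using assms(2) by simp
qed

lemma cyclic_on_fixpoint_iff:
  assumes "cyclic_on f A" "x \<in> A"
  shows "f x = x \<longleftrightarrow> card A = 1"
proof -
  have "f x = x \<longleftrightarrow> A = {x}"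
    using assms orbit_cyclic_eq3[OF assms] orbit_eq_singleton_iff[of f x] by metis
  also have "\<dots> \<longleftrightarrow> card A = 1"
    using assms(2) by (auto simp: card_1_singleton_iff)
  finally show ?thesis .
qed

lemma is_dessin_ends:
  assumes "is_dessin D" "e \<in> arcs (graph D)"
  shows "tail (graph D) e \<in> black D" "head (graph D) e \<in> white D"
  using assms by (auto simp: is_dessin_def)

lemma is_dessin_finite:
  assumes "is_dessin D"
  shows "finite (arcs (graph D))" "finite (black D)" "finite (white D)"
  using assms by (auto simp: is_dessin_def white_def fin_digraph_def fin_digraph_axioms_def
      intro: finite_subset)

lemma edges_at_black:
  assumes "is_dessin D" "v \<in> black D"
  shows "edges_at D v = {e \<in> arcs (graph D). tail (graph D) e = v}"
  using assms is_dessin_ends[OF assms(1)] by (auto simp: edges_at_def white_def)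

lemma edges_at_white:
  assumes "is_dessin D" "v \<in> white D"
  shows "edges_at D v = {e \<in> arcs (graph D). head (graph D) e = v}"
  using assms is_dessin_ends[OF assms(1)] by (auto simp: edges_at_def white_def)

text \<open>
  \<open>turn D k\<close> moves every edge to its successor around the end selected by \<open>k\<close>. Taking \<open>k\<close> to be
  \<open>tail\<close> gives the rotation at the black vertices, taking it to be \<open>head\<close> the one at the white
  vertices, so that one statement about \<open>k\<close> serves both colours.
\<close>

definition turn :: "('v, 'e) dessin \<Rightarrow> ('e \<Rightarrow> 'v) \<Rightarrow> 'e \<Rightarrow> 'e" where
  "turn D k e = rotation D (k e) e"

lemma edges_at_end:
  assumes "is_dessin D" "k \<in> {tail (graph D), head (graph D)}" "e \<in> arcs (graph D)"
  shows "edges_at D (k e) = {f \<in> arcs (graph D). k f = k e}"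
  using assms edges_at_black edges_at_white is_dessin_ends by fastforce

lemma cyclic_on_rotation:
  assumes "is_dessin D" "k \<in> {tail (graph D), head (graph D)}" "e \<in> arcs (graph D)"
  shows "cyclic_on (rotation D (k e)) (edges_at D (k e))"
proof -
  have "k e \<in> verts (graph D)"
    using assms is_dessin_ends[OF assms(1,3)] by (auto simp: is_dessin_def white_def)
  moreover have "edges_at D (k e) \<noteq> {}"
    using assms(3) edges_at_end[OF assms] by auto
  ultimately show ?thesis
    using assms(1) by (auto simp: is_dessin_def)
qed

lemma turn_in_edges_at:
  assumes "is_dessin D" "k \<in> {tail (graph D), head (graph D)}" "e \<in> arcs (graph D)"
  shows "turn D k e \<in> arcs (graph D)" "k (turn D k e) = k e"
proof -
  have "e \<in> edges_at D (k e)"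
    using assms by (simp add: edges_at_end)
  then have "turn D k e \<in> edges_at D (k e)"
    unfolding turn_def using cyclic_on_rotation[OF assms] by (rule cyclic_on_inI[rotated])
  then show "turn D k e \<in> arcs (graph D)" "k (turn D k e) = k e"
    using assms by (simp_all add: edges_at_end)
qed

lemma bij_betw_turn:
  assumes "is_dessin D" "k \<in> {tail (graph D), head (graph D)}"
  shows "bij_betw (turn D k) (arcs (graph D)) (arcs (graph D))"
proof -
  let ?A = "arcs (graph D)"
  have "?A \<subseteq> turn D k ` ?A"
  proof
    fix e assume e: "e \<in> ?A"
    let ?f = "rotation D (k e)"
    have "e \<in> orbit ?f e"
      using orbit_cyclic_eq3[OF cyclic_on_rotation[OF assms e]] e
      by (simp add: edges_at_end[OF assms e])
    then obtain f where "e = ?f f" "f = e \<or> f \<in> orbit ?f e"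
      by (cases rule: orbit.cases) auto
    moreover have "orbit ?f e = edges_at D (k e)"
      using e by (intro orbit_cyclic_eq3 cyclic_on_rotation assms)
        (simp_all add: edges_at_end[OF assms e])
    ultimately have "f \<in> ?A" "k f = k e" "e = ?f f"
      using e by (auto simp: edges_at_end[OF assms e])
    then show "e \<in> turn D k ` ?A"
      by (metis image_eqI turn_def)
  qed
  moreover have "turn D k ` ?A \<subseteq> ?A"
    using turn_in_edges_at[OF assms] by auto
  ultimately show ?thesis
    using is_dessin_finite(1)[OF assms(1)] by (auto simp: bij_betw_def intro: eq_card_imp_inj_on)
qed

text \<open>
  Connectedness of the dessin, read on its edges: a set of edges closed under both turns contains,
  with an edge, all edges at its two ends.
\<close>

lemma turn_closed_imp_all:
  assumes D: "is_dessin D" and E: "E \<subseteq> arcs (graph D)" "E \<noteq> {}"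
    and closed: "turn D (tail (graph D)) ` E \<subseteq> E" "turn D (head (graph D)) ` E \<subseteq> E"
  shows "E = arcs (graph D)"
proof -
  let ?G = "graph D"
  have star: "edges_at D (k e) \<subseteq> E" if "e \<in> E" and k: "k \<in> {tail ?G, head ?G}" for e k
  proof
    have e: "e \<in> arcs ?G"
      using E that by auto
    fix f assume "f \<in> edges_at D (k e)"
    also have "edges_at D (k e) = orbit (rotation D (k e)) e"
      using e by (intro orbit_cyclic_eq3[symmetric] cyclic_on_rotation D k)
        (simp_all add: edges_at_end[OF D k e])
    finally have "f \<in> E \<and> k f = k e"
    proof induction
      case base
      then show ?case
        using \<open>e \<in> E\<close> closed k turn_in_edges_at(2)[OF D k e] by (auto simp: turn_def)
    next
      case (step f)
      then have "turn D k f \<in> E" "k (turn D k f) = k f"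
        using closed k E turn_in_edges_at(2)[OF D k, of f] by auto
      with step show ?case
        by (simp add: turn_def)
    qed
    then show "f \<in> E" ..
  qed
  have meets: "edges_at D v \<subseteq> E" if "edges_at D v \<inter> E \<noteq> {}" for v
    using that star[of _ "tail ?G"] star[of _ "head ?G"] by (fastforce simp: edges_at_def)
  obtain e where e: "e \<in> E"
    using E by auto
  interpret fin_digraph ?G
    using D by (simp add: is_dessin_def)
  have reach: "edges_at D v \<inter> E \<noteq> {}" if "v \<in> verts ?G" for v
  proof -
    have "tail ?G e \<in> verts ?G"
      using e E by auto
    then have "(tail ?G e, v) \<in> rtrancl_on (verts ?G) ((arcs_ends ?G)\<^sup>s)"
      using D that by (simp add: is_dessin_def connected_conv)
    then show ?thesis
    proof (induction rule: rtrancl_on_induct)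
      case base
      then show ?case
        using e E by (auto simp: edges_at_def)
    next
      case (step u w)
      then obtain f where "f \<in> edges_at D u" "f \<in> edges_at D w"
        by (auto simp: symcl_def arcs_ends_conv edges_at_def)
      then show ?case
        using meets[OF step.IH] by auto
    qed
  qed
  have "f \<in> E" if f: "f \<in> arcs ?G" for f
  proof -
    have "edges_at D (tail ?G f) \<subseteq> E"
      using f by (intro meets reach) simp
    then show ?thesis
      using f by (auto simp: edges_at_def)
  qed
  then show ?thesis
    using E by auto
qed

section \<open>Monodromy groups\<close>

lemma relabel_label:
  assumes "labelling D l" "e \<in> arcs (graph D)"
  shows "relabel D l f (l e) = l (f e)"
proof -
  have "l e \<in> {1..card (arcs (graph D))}" "inv_into (arcs (graph D)) l (l e) = e"
    using assms by (auto simp: labelling_def bij_betw_def)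
  then show ?thesis
    by (simp add: relabel_def)
qed

lemma labels_eq_image: "labelling D l \<Longrightarrow> {1..card (arcs (graph D))} = l ` arcs (graph D)"
  by (simp add: labelling_def bij_betw_def)

lemma relabel_permutes:
  assumes l: "labelling D l" and f: "bij_betw f (arcs (graph D)) (arcs (graph D))"
  shows "relabel D l f permutes {1..card (arcs (graph D))}"
proof (rule bij_imp_permutes)
  let ?A = "arcs (graph D)" and ?N = "{1..card (arcs (graph D))}"
  have "bij_betw (l \<circ> f \<circ> inv_into ?A l) ?N ?N"
    using l f unfolding labelling_def by (meson bij_betw_inv_into bij_betw_trans)
  then show "bij_betw (relabel D l f) ?N ?N"
    by (rule bij_betw_cong[THEN iffD1, rotated]) (simp add: relabel_def)
qed (simp only: relabel_def if_False)

lemma sigma_eq_relabel_turn: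
  shows "sigma0 D l = relabel D l (turn D (tail (graph D)))"
    and "sigma1 D l = relabel D l (turn D (head (graph D)))"
  by (simp_all add: sigma0_def sigma1_def turn_def[abs_def])

lemma sigma_permutes:
  assumes "is_dessin D" "labelling D l"
  shows "sigma0 D l permutes {1..card (arcs (graph D))}"
    and "sigma1 D l permutes {1..card (arcs (graph D))}"
  unfolding sigma_eq_relabel_turn using assms by (intro relabel_permutes bij_betw_turn; simp)+

text \<open>The generator \<^const>\<open>sigma_inf\<close> is redundant.\<close>

lemma monodromy_group_two_generators:
  assumes D: "is_dessin D" and l: "labelling D l"
  shows "monodromy_group D l =
    subgroup_generated (sym_group (card (arcs (graph D)))) {sigma0 D l, sigma1 D l}"
proof -
  let ?S = "sym_group (card (arcs (graph D)))"
  let ?X = "{sigma0 D l, sigma1 D l}" and ?Y = "{sigma0 D l, sigma1 D l, sigma_inf D l}"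
  interpret group ?S
    by (rule sym_group_is_group)
  have X: "?X \<subseteq> carrier ?S"
    using sigma_permutes[OF D l] by (simp add: sym_group_carrier)
  then have "sigma_inf D l \<in> carrier ?S"
    unfolding sigma_inf_def Let_def by (intro inv_closed m_closed) auto
  with X have Y: "?Y \<subseteq> carrier ?S"
    by simp
  let ?H = "carrier (subgroup_generated ?S ?X)"
  have H: "subgroup ?H ?S" "?X \<subseteq> ?H"
    using subgroup_generated_subset_carrier_subset[OF X] by (simp_all add: subgroup_subgroup_generated)
  then have "sigma_inf D l \<in> ?H"
    unfolding sigma_inf_def Let_def by (auto intro!: subgroup.m_closed subgroup.m_inv_closed)
  with H have "carrier (subgroup_generated ?S ?Y) \<subseteq> ?H"
    by (intro subgroup_generated_minimal) auto
  moreover have "?H \<subseteq> carrier (subgroup_generated ?S ?Y)"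
    using subgroup_generated_subset_carrier_subset[OF Y]
    by (intro subgroup_generated_minimal subgroup_subgroup_generated) auto
  ultimately have "carrier (subgroup_generated ?S ?Y) = ?H"
    by auto
  then show ?thesis
    by (simp add: monodromy_group_def subgroup_generated_def)
qed

lemma monodromy_group_star:
  assumes D: "is_dessin D" and l: "labelling D l" and b: "black D = {b}"
    and white: "\<And>v. v \<in> white D \<Longrightarrow> degree_at D v = 1" and pos: "arcs (graph D) \<noteq> {}"
  shows "monodromy_group D l \<cong> integer_mod_group (card (arcs (graph D)))"
proof -
  let ?G = "graph D"
  define n where "n = card (arcs ?G)"
  interpret S: group "sym_group n"
    by (rule sym_group_is_group)
  have tail: "tail ?G e = b" if "e \<in> arcs ?G" for e
    using is_dessin_ends[OF D that] b by simp
  then have edges: "edges_at D b = arcs ?G"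
    using edges_at_black[OF D, of b] b by auto
  have "rotation D (head ?G e) e = e" if "e \<in> arcs ?G" for e
    using cyclic_on_fixpoint_iff[OF cyclic_on_rotation[OF D _ that, of "head ?G"], of e]
      white[OF is_dessin_ends(2)[OF D that]] that
    by (simp add: degree_at_def edges_at_def)
  then have s1: "sigma1 D l = id"
    using labels_eq_image[OF l] relabel_label[OF l]
    by (auto simp: fun_eq_iff sigma1_def relabel_def inv_into_into f_inv_into_f)
  have perm: "sigma0 D l permutes {1..n}"
    using sigma_permutes(1)[OF D l] by (simp add: n_def)
  obtain e where "e \<in> arcs ?G"
    using pos by auto
  then have "cyclic_on (rotation D b) (arcs ?G)"
    using cyclic_on_rotation[OF D, of "tail ?G" e] by (simp add: tail edges)
  then have "cyclic_on (sigma0 D l) (l ` arcs ?G)"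
    by (rule cyclic_on_image) (simp add: sigma0_def relabel_label l tail)
  then have "cyclic_on (sigma0 D l) {1..n}"
    by (simp add: labels_eq_image[OF l] n_def del: One_nat_def)
  then have "S.ord (sigma0 D l) = n"
    using perm by (rule ord_cyclic_on[rotated])
  moreover have "n > 0"
    using pos is_dessin_finite(1)[OF D] by (simp add: n_def card_gt_0_iff)
  ultimately show ?thesis
    using S.cyclic_iso_integer_mod_group[of "sigma0 D l"] perm monodromy_group_two_generators[OF D l] s1
    by (simp add: sym_group_carrier sym_group_one n_def)
qed

lemma relabel_turn_involution:
  assumes D: "is_dessin D" and l: "labelling D l" and k: "k \<in> {tail (graph D), head (graph D)}"
    and deg: "\<And>v. v \<in> verts (graph D) \<Longrightarrow> degree_at D v \<le> 2"
  shows "relabel D l (turn D k) \<circ> relabel D l (turn D k) = id"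
proof
  let ?s = "relabel D l (turn D k)"
  fix i
  show "(?s \<circ> ?s) i = id i"
  proof (cases "i \<in> {1..card (arcs (graph D))}")
    case True
    then obtain e where e: "e \<in> arcs (graph D)" "i = l e"
      using labels_eq_image[OF l] by blast
    have "k e \<in> verts (graph D)"
      using k is_dessin_ends[OF D e(1)] D by (auto simp: is_dessin_def white_def)
    then have "card (edges_at D (k e)) \<le> 2"
      using deg by (simp add: degree_at_def)
    then have "rotation D (k e) (rotation D (k e) e) = e"
      using e(1) by (intro cyclic_on_card_le_2[OF cyclic_on_rotation[OF D k e(1)]])
        (simp_all add: edges_at_end[OF D k e(1)])
    then have "turn D k (turn D k e) = e"
      using turn_in_edges_at(2)[OF D k e(1)] by (simp add: turn_def)
    then show ?thesis
      using e turn_in_edges_at[OF D k e(1)] by (simp add: relabel_label[OF l])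
  qed (simp add: relabel_def del: atLeastAtMost_iff)
qed

text \<open>
  The hypothesis asks, within one colour class, for a leaf \<open>u\<close>, whose edge is fixed by the
  corresponding generator, and for a vertex \<open>v\<close> of degree 2, which makes this generator nontrivial.
\<close>

lemma monodromy_group_dihedral:
  assumes D: "is_dessin D" and l: "labelling D l"
    and deg: "\<And>v. v \<in> verts (graph D) \<Longrightarrow> degree_at D v \<le> 2"
    and B: "B \<in> {black D, white D}" and u: "u \<in> B" "degree_at D u = 1"
    and v: "v \<in> B" "degree_at D v = 2"
  shows "monodromy_group D l \<cong> dihedral_group (card (arcs (graph D)))"
proof -
  let ?G = "graph D"
  define n where "n = card (arcs ?G)"
  \<comment> \<open>\<open>k\<close> selects the ends in \<open>B\<close>, and \<open>k'\<close> those of the other colour\<close>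
  obtain k k' where kk': "k = tail ?G \<and> k' = head ?G \<and> B = black D \<or>
      k = head ?G \<and> k' = tail ?G \<and> B = white D"
    using B by auto
  then have k: "k \<in> {tail ?G, head ?G}" and k': "k' \<in> {tail ?G, head ?G}"
    by auto
  define a where "a = relabel D l (turn D k)"
  define b where "b = relabel D l (turn D k')"
  have perm: "a permutes {1..n}" "b permutes {1..n}"
    unfolding a_def b_def n_def using l D k k' by (intro relabel_permutes bij_betw_turn; simp)+
  have invol: "a \<circ> a = id" "b \<circ> b = id"
    unfolding a_def b_def using D l k k' deg by (auto intro!: relabel_turn_involution)
  have edge: "\<exists>e \<in> arcs ?G. k e = w" if "w \<in> B" "degree_at D w \<noteq> 0" for w
  proof -
    have "edges_at D w \<noteq> {}"
      using that(2) by (auto simp: degree_at_def)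
    then show ?thesis
      using that(1) kk' edges_at_black[OF D, of w] edges_at_white[OF D, of w] by auto
  qed
  have turn_fix: "turn D k e = e \<longleftrightarrow> degree_at D (k e) = 1" if "e \<in> arcs ?G" for e
    using cyclic_on_fixpoint_iff[OF cyclic_on_rotation[OF D k that], of e] that
    by (simp add: turn_def degree_at_def edges_at_end[OF D k that])
  have a_fix: "a (l e) = l e \<longleftrightarrow> degree_at D (k e) = 1" if "e \<in> arcs ?G" for e
  proof -
    have "l (turn D k e) = l e \<longleftrightarrow> turn D k e = e"
      using l that turn_in_edges_at(1)[OF D k that]
      by (auto simp: labelling_def bij_betw_def inj_on_def)
    then show ?thesis
      using that by (simp add: a_def relabel_label[OF l] turn_fix)
  qed
  obtain e where e: "e \<in> arcs ?G" "k e = u"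
    using edge[of u] u by auto
  obtain f where f: "f \<in> arcs ?G" "k f = v"
    using edge[of v] v by auto
  have "a (l f) \<noteq> l f"
    using a_fix f v by simp
  then have "a \<noteq> id"
    by auto
  have trans: "T = {1..n}" if T: "T \<subseteq> {1..n}" "T \<noteq> {}" "a ` T \<subseteq> T" "b ` T \<subseteq> T" for T
  proof -
    define E where "E = {e \<in> arcs ?G. l e \<in> T}"
    have lE: "l ` E = T"
      using T(1) labels_eq_image[OF l] by (auto simp: E_def n_def)
    have "turn D k ` E \<subseteq> E" "turn D k' ` E \<subseteq> E"
      using T(3,4) turn_in_edges_at(1)[OF D k] turn_in_edges_at(1)[OF D k']
      by (auto simp: E_def a_def b_def image_subset_iff relabel_label[OF l] dest!: bspec)
    then have "E = arcs ?G"
      using kk' lE T(2) by (intro turn_closed_imp_all D) (auto simp: E_def)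
    then show ?thesis
      using lE labels_eq_image[OF l] by (simp add: n_def)
  qed
  have "subgroup_generated (sym_group n) {a, b} \<cong> dihedral_group n"
    using perm(1) invol(1) perm(2) invol(2) _ _ \<open>a \<noteq> id\<close> trans
  proof (rule transitive_involutions_iso_dihedral_group)
    show "l e \<in> {1..n}"
      using e labels_eq_image[OF l] by (auto simp: n_def)
    show "a (l e) = l e"
      using a_fix e u by simp
  qed
  moreover have "{a, b} = {sigma0 D l, sigma1 D l}"
    using kk' by (auto simp: a_def b_def sigma_eq_relabel_turn)
  ultimately show ?thesis
    using monodromy_group_two_generators[OF D l] by (simp add: n_def)
qed

section \<open>Reading off a passport\<close>

lemma passport_degree:
  assumes "is_dessin D" "passport D = (P, Q)"
  shows "v \<in> black D \<Longrightarrow> degree_at D v \<in># P" "v \<in> white D \<Longrightarrow> degree_at D v \<in># Q"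
    and "d \<in># P \<Longrightarrow> \<exists>v\<in>black D. degree_at D v = d" "d \<in># Q \<Longrightarrow> \<exists>v\<in>white D. degree_at D v = d"
  using assms is_dessin_finite(2,3)[OF assms(1)] by (auto simp: passport_def)

lemma card_arcs_passport:
  assumes D: "is_dessin D" and P: "passport D = (P, Q)"
  shows "card (arcs (graph D)) = sum_mset P"
proof -
  let ?G = "graph D"
  have "card (arcs ?G) = (\<Sum>v\<in>black D. \<Sum>e | e \<in> arcs ?G \<and> tail ?G e = v. 1)"
    using is_dessin_finite[OF D] is_dessin_ends[OF D] by (subst sum.group) auto
  also have "\<dots> = (\<Sum>v\<in>black D. degree_at D v)"
    by (intro sum.cong) (simp_all add: degree_at_def edges_at_black[OF D])
  also have "\<dots> = sum_mset P"
    using P by (auto simp: passport_def sum_unfold_sum_mset)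
  finally show ?thesis .
qed

section \<open>Constructing trees with given passports\<close>

text \<open>Transport of the cyclic shift on \<open>{0..<m}\<close> along an enumeration.\<close>

lemma ex_cyclic_on:
  assumes "finite A" "A \<noteq> {}"
  shows "\<exists>f. cyclic_on f A"
proof -
  define m where "m = card A"
  obtain h where h: "bij_betw h {0..<m} A"
    using ex_bij_betw_nat_finite[OF assms(1)] by (auto simp: m_def)
  have m: "m > 0"
    using assms by (simp add: m_def card_gt_0_iff)
  let ?g = "\<lambda>i. Suc i mod m"
  have pow: "(?g ^^ k) 0 = k mod m" for k
    by (induction k) (simp_all add: mod_Suc_eq)
  have "orbit ?g 0 = {(?g ^^ k) 0 | k. k < m}"
    using m by (intro orbit_altdef_bounded) (simp_all only: pow, simp_all)
  also have "\<dots> = {0..<m}"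
    unfolding pow by (auto intro!: exI[of _ "x :: nat" for x])
  finally have "cyclic_on ?g {0..<m}"
    using m by (intro cyclic_on_singleI[of 0]) simp_all
  then have "cyclic_on (\<lambda>x. h (?g (inv_into {0..<m} h x))) (h ` {0..<m})"
    using h by (rule_tac cyclic_on_image) (auto simp: bij_betw_def)
  then show ?thesis
    using h by (auto simp: bij_betw_def)
qed

text \<open>
  The tree on the vertices \<open>0, \<dots>, n\<close> in which every \<open>e \<ge> 1\<close> is attached to its parent
  \<open>p e < e\<close> by an edge that is also called \<open>e\<close>; \<open>B\<close> is the set of black vertices, and \<open>tail\<close> and
  \<open>head\<close> are chosen so that the tail is the black end.
\<close>

definition attachment_tree ::
    "nat \<Rightarrow> (nat \<Rightarrow> nat) \<Rightarrow> nat set \<Rightarrow> (nat \<Rightarrow> nat \<Rightarrow> nat) \<Rightarrow> (nat, nat) dessin" where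
  "attachment_tree n p B rot =
     \<lparr> graph = \<lparr> verts = {..n}, arcs = {1..n},
                tail = (\<lambda>e. if e \<in> B then e else p e), head = (\<lambda>e. if e \<in> B then p e else e) \<rparr>,
       black = B, rotation = rot \<rparr>"

text \<open>
  Both edges of a cycle at its largest vertex lead to the parent of that vertex, so they coincide;
  the cycle is then a loop, but no vertex is its own parent.
\<close>

lemma attachment_tree_acyclic:
  assumes p: "\<And>e. e \<in> {1..n} \<Longrightarrow> p e < e"
  shows "\<not> undirected_cycle (graph (attachment_tree n p B rot)) vs es"
proof
  assume cyc: "undirected_cycle (graph (attachment_tree n p B rot)) vs es"
  define m where "m = length es"
  have m: "m > 0" "length vs = m" "distinct vs" "distinct es" and "set es \<subseteq> {1..n}"
    using cyc by (auto simp: undirected_cycle_def m_def attachment_tree_def)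
  then have es: "es ! i \<in> {1..n}" if "i < m" for i
    using that by (metis m_def nth_mem subsetD)
  have ends: "{es ! i, p (es ! i)} = {vs ! i, vs ! (Suc i mod m)}" if "i < m" for i
    using cyc that
    by (auto simp: undirected_cycle_def m_def attachment_tree_def insert_commute split: if_splits)
  have "finite (set vs)" "set vs \<noteq> {}"
    using m by auto
  then obtain j where j: "j < m" "vs ! j = Max (set vs)"
    using m(2) Max_in[of "set vs"] by (metis in_set_conv_nth)
  have max: "vs ! i \<le> vs ! j" if "i < m" for i
    using that m(2) by (simp add: j(2))
  have top: "es ! i = vs ! j" if "i < m" "j = i \<or> j = Suc i mod m" for i
  proof -
    have "vs ! i \<le> vs ! j" "vs ! (Suc i mod m) \<le> vs ! j"
      using that m(1) by (auto intro!: max)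
    then show ?thesis
      using ends[OF that(1)] p[OF es[OF that(1)]] that(2)
      by (auto simp: doubleton_eq_iff)
  qed
  \<comment> \<open>the cyclic predecessor of \<open>j\<close>, which is \<open>j\<close> itself if the cycle is a loop\<close>
  define i where "i = (j + m - 1) mod m"
  have i: "i < m" "Suc i mod m = j"
    using j(1) m(1) by (simp_all add: i_def mod_Suc_eq)
  have "es ! i = es ! j"
    using top[of i] top[of j] i j by simp
  then have "i = j"
    using m i j by (simp add: nth_eq_iff_index_eq m_def)
  then have "p (es ! j) = es ! j"
    using ends[OF j(1)] i by auto
  then show False
    using p[OF es[OF j(1)]] by simp
qed

lemma attachment_tree_connected:
  assumes p: "\<And>e. e \<in> {1..n} \<Longrightarrow> p e < e"
  shows "Digraph_Component.connected (graph (attachment_tree n p B rot))"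
proof -
  let ?G = "graph (attachment_tree n p B rot)"
  let ?R = "rtrancl_on (verts ?G) ((arcs_ends ?G)\<^sup>s)"
  have step: "(p e, e) \<in> (arcs_ends ?G)\<^sup>s" "(e, p e) \<in> (arcs_ends ?G)\<^sup>s" if "e \<in> {1..n}" for e
  proof -
    have "{(e, p e), (p e, e)} = {(tail ?G e, head ?G e), (head ?G e, tail ?G e)}" "e \<in> arcs ?G"
      using that by (auto simp: attachment_tree_def)
    then have "{(e, p e), (p e, e)} \<subseteq> (arcs_ends ?G)\<^sup>s"
      by (auto simp: symcl_def arcs_ends_conv)
    then show "(p e, e) \<in> (arcs_ends ?G)\<^sup>s" "(e, p e) \<in> (arcs_ends ?G)\<^sup>s"
      by simp_all
  qed
  have verts: "verts ?G = {..n}"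
    by (simp add: attachment_tree_def)
  have root: "(0, v) \<in> ?R \<and> (v, 0) \<in> ?R" if "v \<le> n" for v
    using that
  proof (induction v rule: less_induct)
    case (less v)
    show ?case
    proof (cases "v = 0")
      case True
      then show ?thesis
        by (simp add: verts)
    next
      case False
      then have v: "v \<in> {1..n}"
        using less.prems by simp
      then have "p v < v" "p v \<le> n"
        using p[OF v] by auto
      with less.IH have "(0, p v) \<in> ?R" "(p v, 0) \<in> ?R"
        by auto
      with step[OF v] less.prems show ?thesis
        by (auto simp: verts intro: rtrancl_on_into_rtrancl_on converse_rtrancl_on_into_rtrancl_on)
    qed
  qed
  then show ?thesis
    unfolding connected_conv verts by (auto intro: rtrancl_on_trans)
qed

lemma edges_at_attachment_tree:
  "edges_at (attachment_tree n p B rot) v = {e \<in> {1..n}. e = v \<or> p e = v}"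
  by (auto simp: edges_at_def attachment_tree_def)

lemma ex_attachment_tree:
  fixes p :: "nat \<Rightarrow> nat"
  assumes p: "\<And>e. e \<in> {1..n} \<Longrightarrow> p e < e" and B: "B \<subseteq> {..n}"
    and colour: "\<And>e. e \<in> {1..n} \<Longrightarrow> p e \<in> B \<longleftrightarrow> e \<notin> B"
  shows "\<exists>T :: (nat, nat) dessin. plane_tree T \<and>
    passport T = (image_mset (\<lambda>v. card {e \<in> {1..n}. e = v \<or> p e = v}) (mset_set B),
                  image_mset (\<lambda>v. card {e \<in> {1..n}. e = v \<or> p e = v}) (mset_set ({..n} - B)))"
proof -
  let ?E = "\<lambda>v. {e \<in> {1..n}. e = v \<or> p e = v}"
  define rot where "rot = (\<lambda>v. SOME f. cyclic_on f (?E v))"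
  have rot: "cyclic_on (rot v) (?E v)" if "?E v \<noteq> {}" for v
  proof -
    have "finite (?E v)"
      by simp
    from someI_ex[OF ex_cyclic_on[OF this that]] show ?thesis
      by (simp only: rot_def)
  qed
  let ?T = "attachment_tree n p B rot"
  have le: "p e \<le> n" if "e \<in> {1..n}" for e
    using p[OF that] that by simp
  have "fin_digraph (graph ?T)"
    using le by unfold_locales (auto simp: attachment_tree_def)
  moreover have "tail (graph ?T) e \<in> black ?T \<and> head (graph ?T) e \<in> white ?T"
    if "e \<in> arcs (graph ?T)" for e
    using that colour[of e] le[of e] by (auto simp: attachment_tree_def white_def)
  ultimately have "is_dessin ?T"
    using B rot attachment_tree_connected[OF p, where B = B and rot = rot]
    unfolding is_dessin_def edges_at_attachment_tree by (auto simp: attachment_tree_def)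
  then have "plane_tree ?T"
    using attachment_tree_acyclic[OF p] by (simp add: plane_tree_def)
  moreover have "passport ?T = (image_mset (\<lambda>v. card (?E v)) (mset_set B),
      image_mset (\<lambda>v. card (?E v)) (mset_set ({..n} - B)))"
    unfolding passport_def degree_at_def edges_at_attachment_tree
    by (simp add: attachment_tree_def white_def)
  ultimately show ?thesis
    by blast
qed

lemma image_mset_mset_set_const:
  assumes "finite A" "\<And>x. x \<in> A \<Longrightarrow> f x = c"
  shows "image_mset f (mset_set A) = replicate_mset (card A) c"
proof -
  have "image_mset f (mset_set A) = image_mset (\<lambda>_. c) (mset_set A)"
    using assms by (intro image_mset_cong) simp
  then show ?thesis
    by (simp add: image_mset_const_eq)
qed

lemma ex_star:
  "\<exists>T :: (nat, nat) dessin. plane_tree T \<and> passport T = ({#r#}, replicate_mset r 1)"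
proof -
  have "{e \<in> {1..r}. e = v \<or> 0 = v} = {v}" if "v \<in> {1..r}" for v
    using that by auto
  then have "image_mset (\<lambda>v. card {e \<in> {1..r}. e = v \<or> 0 = v}) (mset_set {1..r}) =
      replicate_mset r 1"
    by (subst image_mset_mset_set_const[where c = 1]) auto
  moreover have "{..r} - {0} = {1..r}" "{e \<in> {1..r}. e = 0 \<or> 0 = (0::nat)} = {1..r}"
    by auto
  ultimately show ?thesis
    using ex_attachment_tree[of r "\<lambda>_. 0" "{0}"] by auto
qed

lemma path_degree:
  fixes v n :: nat
  assumes "v \<le> n" "n > 0"
  shows "card {e \<in> {1..n}. e = v \<or> e - 1 = v} = (if v = 0 \<or> v = n then 1 else 2)"
proof -
  have "{e \<in> {1..n}. e = v \<or> e - 1 = v} =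
      (if v = 0 then {1} else if v = n then {n} else {v, Suc v})"
    using assms by auto
  then show ?thesis
    by simp
qed

text \<open>
  In a path with vertices \<open>0, \<dots>, n\<close> the colours are the parities. Black is the colour opposite to
  the parity of \<open>n\<close>, so the end \<open>n\<close> is always white.
\<close>

lemma ex_path_odd:
  "\<exists>T :: (nat, nat) dessin. plane_tree T \<and>
    passport T = (replicate_mset r 2 + {#1#}, replicate_mset r 2 + {#1#})"
proof -
  define n where "n = 2 * r + 1"
  define d where "d = (\<lambda>v. card {e \<in> {1..n}. e = v \<or> e - 1 = v})"
  define B where "B = {v. v \<le> n \<and> even v}"
  have d: "d v = (if v = 0 \<or> v = n then 1 else 2)" if "v \<le> n" for v
    unfolding d_def using that by (rule path_degree) (simp add: n_def)
  have B: "B = insert 0 ((\<lambda>k. 2 * k) ` {1..r})"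
    by (auto simp: B_def n_def elim!: evenE)
  have W: "{..n} - B = insert n ((\<lambda>k. 2 * k + 1) ` {..<r})"
  proof (intro equalityI subsetI)
    fix v assume "v \<in> {..n} - B"
    then obtain k where "v = 2 * k + 1" "v \<le> n"
      by (auto simp: B_def elim: oddE)
    then show "v \<in> insert n ((\<lambda>k. 2 * k + 1) ` {..<r})"
      by (cases "k < r") (auto simp: n_def)
  qed (auto simp: B_def n_def)
  have "image_mset d (mset_set ((\<lambda>k. 2 * k) ` {1..r})) = replicate_mset r 2"
    by (subst image_mset_mset_set_const[where c = 2]) (auto simp: d n_def card_image inj_on_def)
  then have "image_mset d (mset_set B) = replicate_mset r 2 + {#1#}"
    unfolding B by (subst mset_set.insert) (auto simp: d n_def)
  moreover have "image_mset d (mset_set ((\<lambda>k. 2 * k + 1) ` {..<r})) = replicate_mset r 2"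
    by (subst image_mset_mset_set_const[where c = 2]) (auto simp: d n_def card_image inj_on_def)
  then have "image_mset d (mset_set ({..n} - B)) = replicate_mset r 2 + {#1#}"
    unfolding W by (subst mset_set.insert) (auto simp: d n_def)
  moreover have "\<exists>T :: (nat, nat) dessin. plane_tree T \<and>
      passport T = (image_mset d (mset_set B), image_mset d (mset_set ({..n} - B)))"
    unfolding d_def by (rule ex_attachment_tree) (auto simp: B_def)
  ultimately show ?thesis
    by metis
qed

lemma ex_path_even:
  assumes "r \<ge> 1"
  shows "\<exists>T :: (nat, nat) dessin. plane_tree T \<and>
    passport T = (replicate_mset r 2, replicate_mset (r - 1) 2 + replicate_mset 2 1)"
proof -
  define n where "n = 2 * r"
  define d where "d = (\<lambda>v. card {e \<in> {1..n}. e = v \<or> e - 1 = v})"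
  define B where "B = {v. v \<le> n \<and> odd v}"
  have n: "n > 0"
    using assms by (simp add: n_def)
  have d: "d v = (if v = 0 \<or> v = n then 1 else 2)" if "v \<le> n" for v
    unfolding d_def using that n by (rule path_degree)
  have B: "B = (\<lambda>k. 2 * k + 1) ` {..<r}"
    by (auto simp: B_def n_def elim!: oddE)
  have W: "{..n} - B = insert 0 (insert n ((\<lambda>k. 2 * k) ` {1..<r}))"
    by (auto simp: B_def n_def elim!: evenE)
  have "image_mset d (mset_set B) = replicate_mset r 2"
    unfolding B
    by (subst image_mset_mset_set_const[where c = 2]) (auto simp: d n_def card_image inj_on_def)
  moreover have "image_mset d (mset_set ((\<lambda>k. 2 * k) ` {1..<r})) = replicate_mset (r - 1) 2"
    by (subst image_mset_mset_set_const[where c = 2]) (auto simp: d n_def card_image inj_on_def)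
  then have "image_mset d (mset_set ({..n} - B)) = replicate_mset (r - 1) 2 + replicate_mset 2 1"
    unfolding W using n
    by (subst mset_set.insert, simp, force, subst mset_set.insert)
      (auto simp: d n_def numeral_2_eq_2)
  moreover have "\<exists>T :: (nat, nat) dessin. plane_tree T \<and>
      passport T = (image_mset d (mset_set B), image_mset d (mset_set ({..n} - B)))"
    unfolding d_def by (rule ex_attachment_tree) (auto simp: B_def)
  ultimately show ?thesis
    by metis
qed

section \<open>The three passports\<close>

lemma monodromy_group_star_passport:
  assumes "r \<ge> 1" and D: "is_dessin D" and l: "labelling D l"
    and P: "passport D = ({#r#}, replicate_mset r 1)"
  shows "monodromy_group D l \<cong> integer_mod_group r"
proof -
  have card: "card (arcs (graph D)) = r"
    using card_arcs_passport[OF D P] by simp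
  obtain b where "black D = {b}"
    using P is_dessin_finite(2)[OF D]
    by (auto simp: passport_def card_1_singleton_iff dest!: arg_cong[of _ "{#_#}" size])
  moreover have "degree_at D v = 1" if "v \<in> white D" for v
    using passport_degree(2)[OF D P that] by (simp split: if_splits)
  moreover have "arcs (graph D) \<noteq> {}"
    using card assms(1) by auto
  ultimately show ?thesis
    using monodromy_group_star[OF D l] card by metis
qed

text \<open>
  The colour with degree list \<open>R\<close> has vertices of both degrees. In the passport of the path with
  \<open>2r\<close> edges this is the white colour, and it has a vertex of degree 2 only if \<open>r \<ge> 2\<close>.
\<close>

lemma monodromy_group_path_passport:
  assumes D: "is_dessin D" and l: "labelling D l" and P: "passport D = (P, Q)"
    and deg: "set_mset P \<subseteq> {1, 2}" "set_mset Q \<subseteq> {1, 2}"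
    and R: "R \<in> {P, Q}" "{1, 2} \<subseteq> set_mset R"
  shows "monodromy_group D l \<cong> dihedral_group (sum_mset P)"
proof -
  have le: "degree_at D v \<le> 2" if "v \<in> verts (graph D)" for v
  proof -
    have "v \<in> black D \<or> v \<in> white D"
      using that by (auto simp: white_def)
    then have "degree_at D v \<in> {1, 2}"
      using passport_degree(1,2)[OF D P, of v] deg by blast
    then show ?thesis
      by auto
  qed
  obtain B where B: "B \<in> {black D, white D}" "\<And>d. d \<in># R \<Longrightarrow> \<exists>v\<in>B. degree_at D v = d"
    using R(1) passport_degree(3,4)[OF D P] by (metis insert_iff singletonD)
  then obtain u v where "u \<in> B" "degree_at D u = 1" "v \<in> B" "degree_at D v = 2"
    using R(2) by (metis insert_subset)
  then have "monodromy_group D l \<cong> dihedral_group (card (arcs (graph D)))"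
    using monodromy_group_dihedral[OF D l le B(1)] by blast
  then show ?thesis
    by (simp add: card_arcs_passport[OF D P])
qed

theorem proposition6:
  fixes r :: nat
  assumes "r \<ge> 1"
  shows
    "((\<exists>T :: (nat, nat) dessin. plane_tree T \<and>
         passport T = ({#r#}, replicate_mset r 1)) \<and>
      (\<forall>(T :: ('v, 'e) dessin) l. plane_tree T \<and> labelling T l \<and>
         passport T = ({#r#}, replicate_mset r 1) \<longrightarrow>
         monodromy_group T l \<cong> integer_mod_group r)) \<and>
     ((\<exists>T :: (nat, nat) dessin. plane_tree T \<and>
         passport T = (replicate_mset r 2 + {#1#}, replicate_mset r 2 + {#1#})) \<and>
      (\<forall>(T :: ('v, 'e) dessin) l. plane_tree T \<and> labelling T l \<and>
         passport T = (replicate_mset r 2 + {#1#}, replicate_mset r 2 + {#1#}) \<longrightarrow>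
         monodromy_group T l \<cong> dihedral_group (2 * r + 1))) \<and>
     ((\<exists>T :: (nat, nat) dessin. plane_tree T \<and>
         passport T = (replicate_mset r 2, replicate_mset (r - 1) 2 + replicate_mset 2 1)) \<and>
      (r \<ge> 2 \<longrightarrow>
        (\<forall>(T :: ('v, 'e) dessin) l. plane_tree T \<and> labelling T l \<and>
           passport T = (replicate_mset r 2, replicate_mset (r - 1) 2 + replicate_mset 2 1) \<longrightarrow>
           monodromy_group T l \<cong> dihedral_group (2 * r))))"
proof (intro conjI allI impI; (elim conjE)?)
  show "\<exists>T :: (nat, nat) dessin. plane_tree T \<and> passport T = ({#r#}, replicate_mset r 1)"
    by (rule ex_star)
  show "\<exists>T :: (nat, nat) dessin. plane_tree T \<and>
      passport T = (replicate_mset r 2 + {#1#}, replicate_mset r 2 + {#1#})"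
    by (rule ex_path_odd)
  show "\<exists>T :: (nat, nat) dessin. plane_tree T \<and>
      passport T = (replicate_mset r 2, replicate_mset (r - 1) 2 + replicate_mset 2 1)"
    using assms by (rule ex_path_even)
next
  fix T :: "('v, 'e) dessin" and l
  assume T: "plane_tree T" and l: "labelling T l"
  then have D: "is_dessin T"
    by (simp add: plane_tree_def)
  show "monodromy_group T l \<cong> integer_mod_group r"
    if "passport T = ({#r#}, replicate_mset r 1)"
    using assms D l that by (rule monodromy_group_star_passport)
  show "monodromy_group T l \<cong> dihedral_group (2 * r + 1)"
    if P: "passport T = (replicate_mset r 2 + {#1#}, replicate_mset r 2 + {#1#})"
    using monodromy_group_path_passport[OF D l P, of "replicate_mset r 2 + {#1#}"] assms
    by (simp add: mult.commute)
  show "monodromy_group T l \<cong> dihedral_group (2 * r)"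
    if "r \<ge> 2" and P: "passport T = (replicate_mset r 2, replicate_mset (r - 1) 2 + replicate_mset 2 1)"
    using monodromy_group_path_passport[OF D l P, of "replicate_mset (r - 1) 2 + replicate_mset 2 1"]
      that(1)
    by (simp add: mult.commute)
qed

end
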